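(* For every $f:\{0,1\}^n\to\{0,1\}$, $\mathsf{alt}(f)\le 2^{\mathsf{DT}(f)+1}-1$.
   Context: $\mathsf{alt}(f)$ is the maximum, over chains $0^n=x_0\prec x_1\prec\dots\prec x_n=1^n$ of distinct inputs (with $\prec$ the coordinatewise order), of the number of $i$ with $f(x_{i-1})\ne f(x_i)$. $\mathsf{DT}(f)$ is the minimum depth of a deterministic decision tree computing $f$. *)

theory Defs
  imports Main
begin

text \<open>A Boolean function on \<^term>\<open>n\<close> variables is a function \<^typ>\<open>bool list \<Rightarrow> bool\<close> together
  with \<^term>\<open>n\<close>; only its values on lists of length \<^term>\<open>n\<close> are ever used, and
  \<^const>\<open>False\<close>, \<^const>\<open>True\<close> stand for 0, 1. This includes the case \<^prop>\<open>n = 0\<close>.\<close>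

definition cube :: "nat \<Rightarrow> bool list set" where
  "cube n = {x. length x = n}"

definition cube_less :: "bool list \<Rightarrow> bool list \<Rightarrow> bool" (infix \<open>\<prec>\<close> 50) where
  "x \<prec> y \<longleftrightarrow> list_all2 (\<le>) x y \<and> x \<noteq> y"

definition max_chain :: "nat \<Rightarrow> (nat \<Rightarrow> bool list) \<Rightarrow> bool" where
  "max_chain n x \<longleftrightarrow>
     (\<forall>i\<le>n. x i \<in> cube n) \<and>
     x 0 = replicate n False \<and> x n = replicate n True \<and>
     (\<forall>i\<in>{1..n}. x (i - 1) \<prec> x i)"

definition alternations :: "nat \<Rightarrow> (bool list \<Rightarrow> bool) \<Rightarrow> (nat \<Rightarrow> bool list) \<Rightarrow> nat" where
  "alternations n f x = card {i \<in> {1..n}. f (x (i - 1)) \<noteq> f (x i)}"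

definition alt :: "nat \<Rightarrow> (bool list \<Rightarrow> bool) \<Rightarrow> nat" where
  "alt n f = Max (alternations n f ` {x. max_chain n x})"

datatype dtree = Leaf bool | Query nat dtree dtree

fun queries :: "dtree \<Rightarrow> nat set" where
  "queries (Leaf b) = {}"
| "queries (Query i t0 t1) = insert i (queries t0 \<union> queries t1)"

fun depth :: "dtree \<Rightarrow> nat" where
  "depth (Leaf b) = 0"
| "depth (Query i t0 t1) = Suc (max (depth t0) (depth t1))"

fun run :: "dtree \<Rightarrow> bool list \<Rightarrow> bool" where
  "run (Leaf b) x = b"
| "run (Query i t0 t1) x = (if x ! i then run t1 x else run t0 x)"

definition computes :: "nat \<Rightarrow> dtree \<Rightarrow> (bool list \<Rightarrow> bool) \<Rightarrow> bool" where
  "computes n t f \<longleftrightarrow> queries t \<subseteq> {..<n} \<and> (\<forall>x\<in>cube n. run t x = f x)"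

definition DT :: "nat \<Rightarrow> (bool list \<Rightarrow> bool) \<Rightarrow> nat" where
  "DT n f = (LEAST d. \<exists>t. computes n t f \<and> depth t = d)"

text \<open>The maximum and the minimum above are attained, so neither operator takes a junk value.\<close>

lemma finite_alternations: "finite (alternations n f ` {x. max_chain n x})"
proof (rule finite_subset)
  show "alternations n f ` {x. max_chain n x} \<subseteq> {..n}"
  proof clarsimp
    fix x
    have "card {i \<in> {1..n}. f (x (i - 1)) \<noteq> f (x i)} \<le> card {1..n}"
      by (intro card_mono) auto
    then show "alternations n f x \<le> n"
      by (simp add: alternations_def)
  qed
qed simp

lemma max_chain_exists: "\<exists>x. max_chain n x"
proof
  let ?x = "\<lambda>i. replicate i True @ replicate (n - i) False"
  have "?x (i - 1) \<prec> ?x i" if i: "i \<in> {1..n}" for i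
  proof -
    have "list_all2 (\<le>) (?x (i - 1)) (?x i)"
      using i by (auto simp: list_all2_conv_all_nth nth_append)
    moreover have "?x (i - 1) ! (i - 1) \<noteq> ?x i ! (i - 1)"
      using i by (auto simp: nth_append)
    ultimately show ?thesis
      by (auto simp: cube_less_def)
  qed
  then show "max_chain n ?x"
    by (simp add: max_chain_def cube_def)
qed

lemma computes_exists: "\<exists>t. computes n t f"
proof -
  have "\<exists>t. queries t \<subseteq> {..<n} \<and> (\<forall>x\<in>cube n. take (n - k) x = p \<longrightarrow> run t x = f x)"
    if "k \<le> n" "length p = n - k" for k p
    using that
  proof (induction k arbitrary: p)
    case 0
    then show ?case
      by (intro exI[of _ "Leaf (f p)"]) (auto simp: cube_def)
  next
    case (Suc k)
    let ?i = "n - Suc k"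
    have "\<exists>t. queries t \<subseteq> {..<n} \<and>
        (\<forall>x\<in>cube n. take (n - k) x = p @ [b] \<longrightarrow> run t x = f x)" for b
      using Suc.prems by (intro Suc.IH) auto
    then obtain t where t: "\<And>b. queries (t b) \<subseteq> {..<n}"
      "\<And>b x. x \<in> cube n \<Longrightarrow> take (n - k) x = p @ [b] \<Longrightarrow> run (t b) x = f x"
      by metis
    have split: "take (n - k) x = take ?i x @ [x ! ?i]" if "x \<in> cube n" for x :: "bool list"
    proof -
      have "n - k = Suc ?i" using Suc.prems by simp
      then show ?thesis
        using that Suc.prems by (simp only:) (rule take_Suc_conv_app_nth, simp add: cube_def)
    qed
    have "run (Query ?i (t False) (t True)) x = f x" if x: "x \<in> cube n" "take ?i x = p" for x
      using t(2)[OF x(1), of "x ! ?i"] split[OF x(1)] x(2) by (cases "x ! ?i") auto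
    then show ?case
      using t(1) Suc.prems by (intro exI[of _ "Query ?i (t False) (t True)"]) auto
  qed
  from this[of n "[]"] show ?thesis
    by (auto simp: computes_def)
qed

lemma alt_attained: "\<exists>x. max_chain n x \<and> alternations n f x = alt n f"
proof -
  have "alt n f \<in> alternations n f ` {x. max_chain n x}"
    unfolding alt_def using finite_alternations max_chain_exists by (intro Max_in) auto
  then show ?thesis by auto
qed

lemma DT_attained: "\<exists>t. computes n t f \<and> depth t = DT n f"
  unfolding DT_def by (rule LeastI_ex) (use computes_exists in blast)

end

theory Submission
  imports Defs
begin

text \<open>Along a monotone chain every queried variable switches at most once. So an alternation of a
  tree with root variable \<^term>\<open>i\<close> is an alternation of one of its two subtrees or the unique
  step at which variable \<^term>\<open>i\<close> switches. Hence a tree of depth \<^term>\<open>d\<close> alternates at most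
  \<open>2 * (2 ^ (d - 1) - 1) + 1 = 2 ^ d - 1\<close> times.\<close>

text \<open>Once \<open>g\<close> has switched on it stays on, so \<open>g (k - 1)\<close> already
  holds at any later \<open>k\<close>.\<close>

lemma card_switches_le_1:
  fixes g :: "nat \<Rightarrow> bool"
  assumes mono: "\<And>j k. j \<le> k \<Longrightarrow> k \<le> n \<Longrightarrow> g j \<Longrightarrow> g k"
  shows "card {k \<in> {1..n}. \<not> g (k - 1) \<and> g k} \<le> 1"
proof -
  have no_later: False
    if "1 \<le> j" "j < k" "k \<le> n" "g j" "\<not> g (k - 1)" for j k
    using mono[of j "k - 1"] that by auto
  have "j = k"
    if "j \<in> {k \<in> {1..n}. \<not> g (k - 1) \<and> g k}" "k \<in> {k \<in> {1..n}. \<not> g (k - 1) \<and> g k}" for j k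
    using that no_later[of j k] no_later[of k j] by (cases j k rule: linorder_cases) auto
  then show ?thesis
    by (simp add: card_le_Suc0_iff_eq)
qed

text \<open>The strict form avoids truncated subtraction and absorbs the extra 1 in the induction: a
  < A and b < B give a + b + 1 < A + B. Monotonicity is assumed only at queried indices, which for a
  tree computing \<open>f\<close> are valid positions.\<close>

lemma alternations_run_less:
  assumes mono: "\<And>i j k. i \<in> queries t \<Longrightarrow> j \<le> k \<Longrightarrow> k \<le> n \<Longrightarrow> x j ! i \<Longrightarrow> x k ! i"
  shows "alternations n (run t) x < 2 ^ depth t"
  using mono
proof (induction t)
  case (Leaf b)
  then show ?case by (simp add: alternations_def)
next
  case (Query i t0 t1)
  let ?A = "\<lambda>t. {k \<in> {1..n}. run t (x (k - 1)) \<noteq> run t (x k)}"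
  let ?S = "{k \<in> {1..n}. \<not> x (k - 1) ! i \<and> x k ! i}"
  have IH: "card (?A t0) < 2 ^ depth t0" "card (?A t1) < 2 ^ depth t1"
    using Query by (simp_all add: alternations_def)
  \<comment> \<open>This excludes a switch from \<open>True\<close> to \<open>False\<close>, so
    outside \<open>?S\<close> both inputs enter the same subtree.\<close>
  have "x (k - 1) ! i \<Longrightarrow> x k ! i" if "k \<in> {1..n}" for k
    using Query.prems[of i "k - 1" k] that by simp
  then have "?A (Query i t0 t1) \<subseteq> ?A t0 \<union> ?A t1 \<union> ?S"
    by (auto split: if_splits)
  then have "card (?A (Query i t0 t1)) \<le> card (?A t0 \<union> ?A t1 \<union> ?S)"
    by (intro card_mono) auto
  also have "\<dots> \<le> card (?A t0) + card (?A t1) + card ?S"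
    by (meson add_le_mono1 card_Un_le le_trans)
  also have "\<dots> \<le> card (?A t0) + card (?A t1) + 1"
    using card_switches_le_1[of n "\<lambda>k. x k ! i"] Query.prems[of i] by simp
  finally have "card (?A (Query i t0 t1)) \<le> card (?A t0) + card (?A t1) + 1" .
  moreover have "(2::nat) ^ depth t0 \<le> 2 ^ max (depth t0) (depth t1)"
    "(2::nat) ^ depth t1 \<le> 2 ^ max (depth t0) (depth t1)"
    by (simp_all add: power_increasing)
  ultimately have "card (?A (Query i t0 t1)) < 2 * 2 ^ max (depth t0) (depth t1)"
    using IH by linarith
  then show ?case
    by (simp only: alternations_def depth.simps power_Suc)
qed

text \<open>\<open>max_chain\<close> compares only neighbours; induction upwards from
  \<open>j\<close> links them.\<close>

lemma max_chain_nth_mono: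
  assumes chain: "max_chain n x" and "i < n" "j \<le> k" "k \<le> n" "x j ! i"
  shows "x k ! i"
  using \<open>j \<le> k\<close> \<open>k \<le> n\<close>
proof (induction k rule: dec_induct)
  case base
  then show ?case using \<open>x j ! i\<close> by simp
next
  case (step k)
  have "x (Suc k - 1) \<prec> x (Suc k)"
    using chain step.prems unfolding max_chain_def by (elim conjE bspec) simp
  moreover have "length (x k) = n"
    using chain step.prems by (simp add: max_chain_def cube_def)
  ultimately show ?case
    using step.IH step.prems \<open>i < n\<close> by (simp add: cube_less_def list_all2_conv_all_nth)
qed

lemma alt_less: "alt n f < 2 ^ DT n f"
proof -
  obtain x where x: "max_chain n x" "alternations n f x = alt n f"
    using alt_attained by blast
  obtain t where t: "computes n t f" "depth t = DT n f"
    using DT_attained by blast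
  \<comment> \<open>Chain points lie in the cube, the only place where \<open>t\<close> must agree
    with \<open>f\<close>.\<close>
  have "run t (x k) = f (x k)" if "k \<le> n" for k
    using x(1) t(1) that by (simp add: max_chain_def computes_def)
  then have "alternations n (run t) x = alternations n f x"
    unfolding alternations_def by (intro arg_cong[where f = card]) auto
  moreover have "alternations n (run t) x < 2 ^ depth t"
  proof (rule alternations_run_less)
    fix i j k
    assume "i \<in> queries t" "j \<le> k" "k \<le> n" "x j ! i"
    moreover from this have "i < n"
      using t(1) by (auto simp: computes_def)
    ultimately show "x k ! i"
      using max_chain_nth_mono[OF x(1)] by blast
  qed
  ultimately show ?thesis
    using x(2) t(2) by simp
qed

theorem theorem8:
  fixes n :: nat and f :: "bool list \<Rightarrow> bool"
  shows "alt n f \<le> 2 ^ (DT n f + 1) - 1"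
  \<comment> \<open>The bound \<open>2 ^ DT n f - 1\<close> is already stronger than the one
    required.\<close>
  using alt_less[of n f] by simp

end
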